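(* For every integer $n\ge 1$ the Narayana polynomial $N_n(x)=\sum_{k=1}^{n}\frac1n\binom{n}{k-1}\binom nk x^k$ is hyperbolic, i.e. all its roots are real.
   Context: A univariate polynomial is called hyperbolic if all its (complex) roots are real. *)

theory Defs
  imports Complex_Main "HOL-Computational_Algebra.Polynomial"
begin

(* The zero polynomial, having every complex number as a root, is not hyperbolic. *)
definition hyperbolic :: "real poly \<Rightarrow> bool" where
  "hyperbolic p \<longleftrightarrow>
     (\<forall>z::complex. poly (map_poly complex_of_real p) z = 0 \<longrightarrow> z \<in> \<real>)"

definition narayana_poly :: "nat \<Rightarrow> real poly" where
  "narayana_poly n =
     (\<Sum>k=1..n. monom (1 / real n * real (n choose (k - 1)) * real (n choose k)) k)"

end

theory Submission
  imports Defs "HOL-Computational_Algebra.Fundamental_Theorem_Algebra"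
begin

text \<open>
  The Narayana polynomial is, up to a fractional linear change of variable, a higher
  derivative of a polynomial with real roots only. Applying the Leibniz rule to
  \<open>x\<^sup>n (x - 1)\<^sup>n\<close> gives the Rodrigues-type formula (\<open>rodrigues_narayana\<close>)

    \<open>D\<^bsup>n-1\<^esup> (x\<^sup>n (x - 1)\<^sup>n) = n! x\<^bsup>n+1\<^esup> N\<^sub>n((x - 1) / x)\<close>.

  By the real case of the Gauss-Lucas theorem (\<open>pderiv_roots_real\<close>), differentiation preserves
  real-rootedness of a polynomial of positive degree, so all roots of the left-hand side are
  real. Every \<open>z \<noteq> 1\<close> can be written as \<open>z = (x - 1) / x\<close> with \<open>x = 1 / (1 - z) \<noteq> 0\<close>; if
  \<open>z\<close> is a root of \<open>N\<^sub>n\<close>, then \<open>x\<close> is a root of the derivative, hence real, and so is \<open>z\<close>.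
\<close>

text \<open>
  The logarithmic derivative of \<open>p\<close> is the sum of the terms \<open>1 / (z - a)\<close> over the roots \<open>a\<close>.
  For real \<open>a\<close>, each term has imaginary part \<open>- Im z / \<bar>z - a\<bar>\<^sup>2\<close>, of sign opposite to that of
  \<open>Im z\<close>, so off the real axis the terms cannot cancel. The non-strict inequality lets the
  induction start from the empty multiset.
\<close>
lemma Im_logderiv_of_real_roots:
  fixes A :: "complex multiset" and z :: complex
  assumes "set_mset A \<subseteq> \<real>" and "Im z \<noteq> 0"
  defines "p \<equiv> (\<Prod>a\<in>#A. [:-a, 1:])"
  shows "poly p z \<noteq> 0 \<and> Im z * Im (poly (pderiv p) z / poly p z) \<le> 0 \<and>
         (A \<noteq> {#} \<longrightarrow> Im z * Im (poly (pderiv p) z / poly p z) < 0)"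
  using assms(1) unfolding p_def
proof (induction A)
  case empty
  then show ?case by simp
next
  case (add a A)
  let ?q = "\<Prod>a\<in>#A. [:-a, 1:]"
  have IH: "poly ?q z \<noteq> 0" "Im z * Im (poly (pderiv ?q) z / poly ?q z) \<le> 0"
    using add by auto
  from add.prems have "a \<in> \<real>" by simp
  then obtain r where r: "a = of_real r" by (elim Reals_cases)
  have za: "z - a \<noteq> 0" using \<open>Im z \<noteq> 0\<close> by (auto simp: r complex_eq_iff)
  have "Im z * Im (1 / (z - a)) = - ((Im z)\<^sup>2 / (cmod (z - a))\<^sup>2)"
    unfolding Im_divide cmod_power2 by (simp add: r power2_eq_square)
  also have "\<dots> < 0"
    using za \<open>Im z \<noteq> 0\<close> by simp
  finally have neg: "Im z * Im (1 / (z - a)) < 0" .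
  have "pderiv ([:-a, 1:] * ?q) = [:-a, 1:] * pderiv ?q + ?q"
    by (simp only: pderiv_mult) (simp add: pderiv_pCons)
  then have ld: "poly (pderiv ([:-a, 1:] * ?q)) z / poly ([:-a, 1:] * ?q) z =
          1 / (z - a) + poly (pderiv ?q) z / poly ?q z"
    using za IH(1) by (simp add: field_simps del: mult_pCons_left)
  have "Im z * Im (poly (pderiv ([:-a, 1:] * ?q)) z / poly ([:-a, 1:] * ?q) z) < 0"
    unfolding ld using neg IH(2) by (simp add: distrib_left)
  moreover have "poly ([:-a, 1:] * ?q) z \<noteq> 0" using za IH(1) by simp
  ultimately show ?case by simp
qed

text \<open>
  The real case of the Gauss-Lucas theorem. The degree must be positive because the derivative of
  a nonzero constant vanishes everywhere.
\<close>
lemma pderiv_roots_real: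
  fixes p :: "complex poly"
  assumes "\<And>z. poly p z = 0 \<Longrightarrow> z \<in> \<real>" and "degree p > 0"
    and "poly (pderiv p) z = 0"
  shows "z \<in> \<real>"
proof (rule ccontr)
  assume "z \<notin> \<real>"
  then have Im: "Im z \<noteq> 0" by (simp add: complex_is_Real_iff)
  have "p \<noteq> 0" using assms(2) by auto
  then obtain A where A: "size A = degree p" "p = smult (lead_coeff p) (\<Prod>a\<in>#A. [:-a, 1:])"
    using alg_closed_imp_factorization by metis
  let ?q = "\<Prod>a\<in>#A. [:-a, 1:]"
  have "set_mset A \<subseteq> \<real>"
  proof
    fix a assume "a \<in># A"
    then have "poly ?q a = 0"
      by (auto simp: poly_prod_mset prod_mset_zero_iff)
    then have "poly p a = 0"
      by (subst A(2)) simp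
    then show "a \<in> \<real>" by (rule assms(1))
  qed
  moreover have "A \<noteq> {#}" using A(1) assms(2) by auto
  ultimately have "Im z * Im (poly (pderiv ?q) z / poly ?q z) < 0"
    using Im_logderiv_of_real_roots[OF _ Im] by blast
  then have "poly (pderiv ?q) z \<noteq> 0" by auto
  moreover have "poly (pderiv p) z = lead_coeff p * poly (pderiv ?q) z"
    by (subst A(2)) (simp add: pderiv_smult)
  ultimately show False using assms(3) \<open>p \<noteq> 0\<close> by simp
qed

lemma higher_pderiv_roots_real:
  fixes p :: "complex poly"
  assumes "\<And>z. poly p z = 0 \<Longrightarrow> z \<in> \<real>" and "m < degree p"
    and "poly ((pderiv ^^ m) p) z = 0"
  shows "z \<in> \<real>"
  using assms(2,3)
proof (induction m arbitrary: z)
  case 0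
  then show ?case using assms(1) by simp
next
  case (Suc m)
  have "poly ((pderiv ^^ m) p) w = 0 \<Longrightarrow> w \<in> \<real>" for w
    using Suc by simp
  moreover have "degree ((pderiv ^^ m) p) > 0"
    using Suc.prems by (simp add: degree_higher_pderiv)
  ultimately show ?case
    using pderiv_roots_real[of "(pderiv ^^ m) p" z] Suc.prems by simp
qed

lemma higher_pderiv_mult:
  fixes p q :: "'a :: {comm_semiring_1, semiring_no_zero_divisors} poly"
  shows "(pderiv ^^ m) (p * q) =
    (\<Sum>j\<le>m. of_nat (m choose j) * (pderiv ^^ j) p * (pderiv ^^ (m - j)) q)"
proof (induction m)
  case 0
  then show ?case by simp
next
  case (Suc m)
  let ?D = "\<lambda>k. pderiv ^^ k"
  let ?t = "\<lambda>i j. ?D i p * ?D j q"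
  have "?D (Suc m) (p * q) =
      (\<Sum>j\<le>m. of_nat (m choose j) * ?t (Suc j) (m - j)) +
      (\<Sum>j\<le>m. of_nat (m choose j) * ?t j (Suc m - j))"
    by (simp add: Suc higher_pderiv_sum[of 1, simplified] pderiv_smult smult_add_right pderiv_mult of_nat_poly pderiv_pCons Suc_diff_le
        sum.distrib[symmetric] algebra_simps)
  (* The extra summand is zero; it makes room for the index shift that Pascal's rule needs. *)
  also have "(\<Sum>j\<le>m. of_nat (m choose j) * ?t j (Suc m - j)) =
      (\<Sum>j\<le>Suc m. of_nat (m choose j) * ?t j (Suc m - j))"
    by (simp add: binomial_eq_0)
  also have "\<dots> = ?t 0 (Suc m) +
      (\<Sum>j\<le>m. of_nat (m choose Suc j) * ?t (Suc j) (m - j))"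
    by (subst sum.atMost_Suc_shift) simp
  also have "(\<Sum>j\<le>m. of_nat (m choose j) * ?t (Suc j) (m - j)) + \<dots> =
      ?t 0 (Suc m) + (\<Sum>j\<le>m. of_nat (Suc m choose Suc j) * ?t (Suc j) (m - j))"
    by (simp add: sum.distrib algebra_simps)
  also have "\<dots> = (\<Sum>j\<le>Suc m. of_nat (Suc m choose j) * ?t j (Suc m - j))"
    by (subst sum.atMost_Suc_shift) simp
  finally show ?case by (simp only: mult.assoc)
qed

lemma higher_pderiv_linear_power:
  fixes a :: "'a :: {idom, semiring_char_0}"
  assumes "j \<le> n"
  shows "(pderiv ^^ j) ([:a, 1:] ^ n) = smult (of_nat (fact j * (n choose j))) ([:a, 1:] ^ (n - j))"
  using assms
proof (induction j)
  case 0
  then show ?case by simp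
next
  case (Suc j)
  then obtain k where k: "n - j = Suc k" "n - Suc j = k"
    by (metis Suc_diff_Suc Suc_le_lessD)
  have "(n choose Suc j) * Suc j = (n choose j) * Suc k"
    using k Suc.prems
    by (metis Suc_times_binomial_eq binomial_absorb_comp binomial_absorption diff_Suc_1 mult.commute)
  then have c: "fact j * (n choose j) * Suc k = fact (Suc j) * (n choose Suc j)"
    by (metis fact_Suc mult.assoc mult.commute of_nat_id)
  have "(pderiv ^^ Suc j) ([:a, 1:] ^ n) =
      smult (of_nat (fact j * (n choose j) * Suc k)) ([:a, 1:] ^ k)"
    using Suc k by (simp add: pderiv_smult pderiv_power_Suc pderiv_pCons distrib_left del: power_Suc)
  then show ?case by (simp only: c k)
qed

text \<open>
  With \<open>m = n - 1\<close>, the \<open>j\<close>-th Leibniz summand carries the coefficient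
  \<open>(m choose j) \<cdot> j! (n choose j) \<cdot> (m - j)! (n choose (m - j))\<close>. The first binomial coefficient
  and the two factorials combine to \<open>m!\<close>, and \<open>n choose (m - j) = n choose (j + 1)\<close> by symmetry,
  which leaves \<open>m!\<close> times the product of adjacent binomial coefficients that occurs in the
  Narayana number of index \<open>j + 1\<close>. The summand is homogeneous of degree \<open>n + 1\<close> in \<open>x\<close> and
  \<open>x - 1\<close>, so dividing by \<open>x\<^bsup>n+1\<^esup>\<close> turns it into a power of \<open>(x - 1) / x\<close>.
\<close>
lemma rodrigues_narayana:
  fixes x :: complex
  assumes "n \<ge> 1" and "x \<noteq> 0"
  shows "poly ((pderiv ^^ (n - 1)) ([:0, 1:] ^ n * [:-1, 1:] ^ n)) x =
         fact n * x ^ (n + 1) * poly (map_poly of_real (narayana_poly n)) ((x - 1) / x)"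
proof -
  obtain m where n: "n = Suc m" using assms(1) by (cases n) auto
  let ?c = "\<lambda>j. of_nat (n choose j) * of_nat (n choose Suc j) :: complex"
  let ?y = "(x - 1) / x"
  have term_eq: "poly (of_nat (m choose j) * (pderiv ^^ j) ([:0, 1:] ^ n) *
          (pderiv ^^ (m - j)) ([:-1, 1:] ^ n)) x = fact m * x ^ (n + 1) * (?c j * ?y ^ Suc j)"
    if "j \<le> m" for j
  proof -
    have c: "n choose (m - j) = n choose Suc j"
      using binomial_symmetric[of "Suc j" n] that by (simp add: n)
    have d: "n - (m - j) = Suc j" using that by (simp add: n)
    have f: "of_nat (m choose j) * (fact j * fact (m - j)) = (fact m :: complex)"
      using binomial_fact_lemma[OF that] by (metis mult.commute of_nat_fact of_nat_mult)
    have e: "x ^ (n - j) * (x - 1) ^ Suc j = x ^ (n + 1) * ?y ^ Suc j"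
    proof -
      have "n + 1 = (n - j) + Suc j" using that by (simp add: n)
      then have "x ^ (n + 1) = x ^ (n - j) * x ^ Suc j" by (metis power_add)
      then show ?thesis using assms(2) by (simp add: power_divide)
    qed
    have "poly (of_nat (m choose j) * (pderiv ^^ j) ([:0, 1:] ^ n) *
          (pderiv ^^ (m - j)) ([:-1, 1:] ^ n)) x = 
       of_nat (m choose j) * (fact j * fact (m - j)) * ?c j * (x ^ (n - j) * (x - 1) ^ Suc j)"
      using that by (simp add: higher_pderiv_linear_power c[unfolded n] d[unfolded n] n mult_ac del: power_Suc binomial_Suc_Suc)
    also have "\<dots> = fact m * ?c j * (x ^ (n + 1) * ?y ^ Suc j)"
      by (simp only: f e)
    finally show ?thesis by (simp only: mult_ac)
  qed
  have map_eq: "map_poly of_real (narayana_poly n) =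
      (\<Sum>k=1..n. monom (complex_of_real (1 / real n * real (n choose (k - 1)) * real (n choose k))) k)"
    by (intro poly_eqI) (simp add: narayana_poly_def coeff_map_poly coeff_sum if_distrib cong: if_cong)
  have "of_nat n * poly (map_poly of_real (narayana_poly n)) ?y =
      (\<Sum>k=1..n. of_nat (n choose (k - 1)) * of_nat (n choose k) * ?y ^ k)"
    using assms(1) by (simp add: map_eq poly_sum poly_monom sum_distrib_left)
  also have "\<dots> = (\<Sum>j\<le>m. ?c j * ?y ^ Suc j)"
    unfolding n One_nat_def by (subst sum.shift_bounds_cl_Suc_ivl) (simp add: atMost_atLeast0)
  finally have N: "of_nat n * poly (map_poly of_real (narayana_poly n)) ?y =
      (\<Sum>j\<le>m. ?c j * ?y ^ Suc j)" .
  have "poly ((pderiv ^^ (n - 1)) ([:0, 1:] ^ n * [:-1, 1:] ^ n)) x =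
      (\<Sum>j\<le>m. fact m * x ^ (n + 1) * (?c j * ?y ^ Suc j))"
    unfolding higher_pderiv_mult poly_sum
    using term_eq by (intro sum.cong) (auto simp: n)
  also have "\<dots> = fact m * x ^ (n + 1) * (of_nat n * poly (map_poly of_real (narayana_poly n)) ?y)"
    unfolding N by (simp only: sum_distrib_left)
  also have "\<dots> = fact n * x ^ (n + 1) * poly (map_poly of_real (narayana_poly n)) ?y"
    by (simp add: n algebra_simps)
  finally show ?thesis .
qed

theorem corollary6:
  fixes n :: nat
  assumes "n \<ge> 1"
  shows "hyperbolic (narayana_poly n)"
  unfolding hyperbolic_def
proof (intro allI impI)
  fix z :: complex
  assume root: "poly (map_poly complex_of_real (narayana_poly n)) z = 0"
  show "z \<in> \<real>"
  proof (cases "z = 1")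
    case False
    define x where "x = 1 / (1 - z)"
    have "x \<noteq> 0" and z: "z = (x - 1) / x"
      using False by (auto simp: x_def field_simps)
    let ?f = "[:0, 1:] ^ n * [:-1, 1:] ^ n :: complex poly"
    have "poly ((pderiv ^^ (n - 1)) ?f) x = 0"
      using rodrigues_narayana[OF assms \<open>x \<noteq> 0\<close>] root by (simp flip: z)
    moreover have "n - 1 < degree ?f"
      using assms by (simp add: degree_mult_eq degree_power_eq)
    moreover have "w \<in> \<real>" if "poly ?f w = 0" for w
      using that by (auto split: if_splits)
    ultimately have "x \<in> \<real>"
      using higher_pderiv_roots_real by blast
    then show ?thesis unfolding z by simp
  qed simp
qed

end
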